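(* Let $K$ be a finite field of characteristic $p$, let $A_1,\ldots,A_s$ be subgroups of the multiplicative group $K^*$, let $B_i=A_i\cup\{0\}$ and $e_i=|B_i|$, let $\mathcal{X}=B_1\times\cdots\times B_s\subset K^s$, and let $r_0=\sum_{i=1}^s(e_i-1)$. Assume that $\gcd(e_i,p)=p$ for all $i$. Then for every integer $d$ with $-1\le d\le r_0$, $C_{\mathcal{X}}(d)^\perp=C_{\mathcal{X}}(r_0-d-1)$ if $d<r_0$, and $C_{\mathcal{X}}(d)^\perp=(0)$ if $d=r_0$.
   Context: Let $S=K[t_1,\ldots,t_s]$ and $\mathcal{X}=\{P_1,\ldots,P_m\}$. $S_{\le d}$ is the $K$-space of polynomials of total degree at most $d$, with $S_{\le -1}=\{0\}$. $C_{\mathcal{X}}(d)=\{(f(P_1),\ldots,f(P_m)): f\in S_{\le d}\}\subset K^m$ is the Reed--Muller-type code of degree $d$ on $\mathcal{X}$. For a linear code $C\subset K^m$, $C^\perp$ is its dual for the ordinary inner product. The number $r_0$ equals the regularity index of the affine Hilbert function of the vanishing ideal of $\mathcal{X}$. *)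

theory Defs
  imports
    "HOL-Library.Poly_Mapping"
    "HOL-Algebra.Multiplicative_Group"
    "Jordan_Normal_Form.VS_Connect"
begin

(* Multivariate polynomials over 'a in the variables t_i, i :: 's: a monomial is its exponent
   vector 's \<Rightarrow>\<^sub>0 nat, and a polynomial maps each monomial to its coefficient. *)
type_synonym ('s, 'a) mpolynomial = "('s \<Rightarrow>\<^sub>0 nat) \<Rightarrow>\<^sub>0 'a"

definition monomial_degree :: "('s::finite \<Rightarrow>\<^sub>0 nat) \<Rightarrow> nat" where
  "monomial_degree \<alpha> = (\<Sum>i\<in>UNIV. Poly_Mapping.lookup \<alpha> i)"

definition poly_eval :: "('s::finite, 'a::comm_ring_1) mpolynomial \<Rightarrow> ('s \<Rightarrow> 'a) \<Rightarrow> 'a" where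
  "poly_eval f x = (\<Sum>\<alpha>\<in>Poly_Mapping.keys f. Poly_Mapping.lookup f \<alpha> * (\<Prod>i\<in>UNIV. x i ^ Poly_Mapping.lookup \<alpha> i))"

(* The degree bound is an integer; for d < 0 only the zero polynomial qualifies. *)
definition polys_degree_le :: "int \<Rightarrow> ('s::finite, 'a::comm_ring_1) mpolynomial set" where
  "polys_degree_le d = {f. \<forall>\<alpha>\<in>Poly_Mapping.keys f. int (monomial_degree \<alpha>) \<le> d}"

(* The evaluation points P_1, ..., P_m are indexed here as P 0, ..., P (m - 1). *)
definition reed_muller_type_code ::
  "nat \<Rightarrow> (nat \<Rightarrow> 's::finite \<Rightarrow> 'a::comm_ring_1) \<Rightarrow> int \<Rightarrow> 'a vec set" where
  "reed_muller_type_code m P d = (\<lambda>f. vec m (\<lambda>j. poly_eval f (P j))) ` polys_degree_le d"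

definition dual_code :: "nat \<Rightarrow> 'a::comm_ring_1 vec set \<Rightarrow> 'a vec set" where
  "dual_code m C = {w \<in> carrier_vec m. \<forall>c\<in>C. w \<bullet> c = 0}"

end

theory Submission
  imports Defs "HOL-Computational_Algebra.Polynomial"
begin

text \<open>
  Write \<open>n\<^sub>i = |A\<^sub>i|\<close>, so that \<open>B\<^sub>i\<close> is the set of roots of \<open>x\<^bsup>n\<^sub>i+1\<^esup> - x\<close>, a polynomial whose derivative is the
  constant \<open>-1\<close> because \<open>p\<close> divides \<open>n\<^sub>i + 1\<close>. Everything follows from two consequences of this.

  The power sums \<open>\<Sum>b\<in>B\<^sub>i. b\<^bsup>k\<^esup>\<close> vanish for \<open>k < n\<^sub>i\<close> (\<open>power_sum_insert_zero_eq_0\<close>). A monomial of degree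
  less than \<open>r\<^sub>0 = \<Sum>n\<^sub>i\<close> has some exponent less than \<open>n\<^sub>i\<close>, so its sum over the grid factors
  with a factor zero. Since the degrees \<open>d\<close> and \<open>r\<^sub>0 - d - 1\<close> add up to \<open>r\<^sub>0 - 1\<close>, the
  codes of these degrees are orthogonal.

  The Lagrange basis polynomial of a node \<open>a \<in> B\<^sub>i\<close> is
  \<open>1 - \<Sum>k\<le>n\<^sub>i. a\<^bsup>n\<^sub>i-k\<^esup> x\<^bsup>k\<^esup>\<close>, and its coefficient of \<open>x\<^bsup>k\<^esup>\<close> is a polynomial in \<open>a\<close> of degree at
  most \<open>n\<^sub>i - k\<close>. Hence in the interpolation formula for a word \<open>w\<close> on the grid, the
  coefficient of \<open>x\<^bsup>\<alpha>\<^esup>\<close> is the inner product of \<open>w\<close> with the evaluations of a polynomial of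
  degree at most \<open>r\<^sub>0 - |\<alpha>|\<close>. If \<open>w\<close> is orthogonal to the code of degree \<open>d\<close>, this coefficient is
  zero whenever \<open>|\<alpha>| \<ge> r\<^sub>0 - d\<close>, so \<open>w\<close> is the evaluation of a polynomial of degree at most
  \<open>r\<^sub>0 - d - 1\<close>. For \<open>d = r\<^sub>0\<close> this degree is \<open>-1\<close> and the code is zero.
\<close>

section \<open>Multiplicatively closed subsets of a finite field\<close>

lemma mult_closed_image_eq:
  fixes A :: "'a::field set"
  assumes "finite A" "0 \<notin> A" and mult: "\<And>x y. x \<in> A \<Longrightarrow> y \<in> A \<Longrightarrow> x * y \<in> A" and "x \<in> A"
  shows "inj_on ((*) x) A" and "(*) x ` A = A"
proof -
  from assms have "x \<noteq> 0" by auto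
  then show inj: "inj_on ((*) x) A" by (auto intro: inj_onI)
  show "(*) x ` A = A"
    by (rule endo_inj_surj) (use assms inj in auto)
qed

lemma power_card_eq_one:
  fixes A :: "'a::field set"
  assumes "finite A" "0 \<notin> A" and mult: "\<And>x y. x \<in> A \<Longrightarrow> y \<in> A \<Longrightarrow> x * y \<in> A" and "x \<in> A"
  shows "x ^ card A = 1"
proof -
  note im = mult_closed_image_eq[OF assms]
  \<comment> \<open>Multiplication by \<open>x\<close> permutes \<open>A\<close>, so the product of the elements gains a factor \<open>x ^ card A\<close>.\<close>
  have "\<Prod>A = (\<Prod>y\<in>A. x * y)"
    using prod.reindex[OF im(1), of "\<lambda>y. y"] im(2) by simp
  also have "\<dots> = x ^ card A * \<Prod>A"
    by (simp add: prod.distrib)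
  finally show ?thesis
    using assms(1,2) by (metis mult_cancel_right2 prod_zero_iff)
qed

text \<open>For \<open>0 < k < card A\<close> some \<open>x \<in> A\<close> has \<open>x ^ k \<noteq> 1\<close>, since \<open>t ^ k - 1\<close> has at most \<open>k\<close> roots;
  multiplying the summation variable by \<open>x\<close> multiplies the power sum by \<open>x ^ k\<close>, which
  forces it to vanish. For \<open>k = 0\<close> the sum is \<open>card A + 1\<close>, which explains the condition on
  the characteristic.\<close>

lemma power_sum_insert_zero_eq_0:
  fixes A :: "'a::field set"
  assumes "finite A" "0 \<notin> A" and mult: "\<And>x y. x \<in> A \<Longrightarrow> y \<in> A \<Longrightarrow> x * y \<in> A"
    and char: "of_nat (card A + 1) = (0::'a)" and k: "k < card A"
  shows "(\<Sum>b\<in>insert 0 A. b ^ k) = 0"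
proof (cases "k = 0")
  case True
  have "(\<Sum>b\<in>insert 0 A. b ^ k) = of_nat (card (insert 0 A))"
    using True by simp
  also have "card (insert 0 A) = card A + 1"
    using assms(1,2) by simp
  finally show ?thesis using char by simp
next
  case False
  define q :: "'a poly" where "q = monom 1 k - 1"
  have "coeff q k = 1" using False by (simp add: q_def)
  then have "q \<noteq> 0" by auto
  have "degree q \<le> k"
    unfolding q_def by (rule degree_diff_le) (auto simp: degree_monom_le)
  have "\<not> A \<subseteq> {x. poly q x = 0}"
  proof
    assume "A \<subseteq> {x. poly q x = 0}"
    then have "card A \<le> card {x. poly q x = 0}"
      using poly_roots_finite[OF \<open>q \<noteq> 0\<close>] by (intro card_mono)
    then show False
      using card_poly_roots_bound[OF \<open>q \<noteq> 0\<close>] \<open>degree q \<le> k\<close> k by linarith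
  qed
  then obtain x where x: "x \<in> A" "x ^ k \<noteq> 1"
    by (auto simp: q_def poly_monom)
  note im = mult_closed_image_eq[OF assms(1,2) mult x(1)]
  have "(\<Sum>b\<in>A. b ^ k) = (\<Sum>b\<in>A. (x * b) ^ k)"
    using sum.reindex[OF im(1), of "\<lambda>y. y ^ k"] im(2) by simp
  also have "\<dots> = x ^ k * (\<Sum>b\<in>A. b ^ k)"
    by (simp add: power_mult_distrib sum_distrib_left)
  finally have "(\<Sum>b\<in>A. b ^ k) = 0"
    using x(2) by (metis mult_cancel_right2)
  then show ?thesis using assms(1,2) False by (simp add: power_0_left)
qed

section \<open>Interpolation with low-degree coefficients\<close>

text \<open>The coefficient of \<open>x ^ k\<close> in the Lagrange basis polynomial of the node \<open>a\<close> among
  the roots of \<open>x ^ (n + 1) - x\<close>, see \<open>sum_lagrange_coeff\<close>.\<close>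

definition lagrange_coeff :: "nat \<Rightarrow> nat \<Rightarrow> 'a::comm_ring_1 \<Rightarrow> 'a" where
  "lagrange_coeff n k a = of_bool (k = 0) - a ^ (n - k)"

text \<open>Multiplying \<open>\<Sum>k\<le>n. a ^ (n - k) * x ^ k\<close> by \<open>x - a\<close> gives \<open>x ^ (n + 1) - a ^ (n + 1) = x - a\<close>,
  so the sum is \<open>1\<close> off the diagonal; on it, all \<open>n + 1\<close> summands agree, and the
  characteristic makes it \<open>0\<close>.\<close>

lemma sum_lagrange_coeff:
  fixes a x :: "'a::field"
  assumes "a ^ Suc n = a" "x ^ Suc n = x" "of_nat (Suc n) = (0::'a)"
  shows "(\<Sum>k\<le>n. lagrange_coeff n k a * x ^ k) = of_bool (a = x)"
proof -
  have "(\<Sum>k\<le>n. lagrange_coeff n k a * x ^ k) =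
        (\<Sum>k\<le>n. of_bool (k = 0) * x ^ k) - (\<Sum>k\<le>n. a ^ (n - k) * x ^ k)"
    by (simp add: lagrange_coeff_def left_diff_distrib sum_subtractf)
  also have "(\<Sum>k\<le>n. of_bool (k = 0) * x ^ k) = (\<Sum>k\<in>{0}. x ^ k)"
    by (rule sum.mono_neutral_cong_right) auto
  also have "(\<Sum>k\<le>n. a ^ (n - k) * x ^ k) = of_bool (a \<noteq> x)"
  proof (cases "a = x")
    case True
    have "(\<Sum>k\<le>n. a ^ (n - k) * x ^ k) = (\<Sum>k\<le>n. x ^ n)"
      using True by (intro sum.cong) (auto simp flip: power_add)
    also have "\<dots> = of_nat (Suc n) * x ^ n" by simp
    finally show ?thesis using assms(3) True by simp
  next
    case False
    have "x - a = (x - a) * (\<Sum>k<Suc n. x ^ k * a ^ (n - k))"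
      using diff_power_eq_sum[of x n a] unfolding assms(1,2) .
    then have "(\<Sum>k<Suc n. x ^ k * a ^ (n - k)) = 1"
      using False by (metis mult_cancel_left2 right_minus_eq)
    then show ?thesis using False by (simp add: lessThan_Suc_atMost mult.commute)
  qed
  finally show ?thesis by auto
qed

lemma sum_prod_lagrange_coeff:
  fixes a x :: "'s::finite \<Rightarrow> 'a::field"
  assumes "\<And>i. a i ^ Suc (n i) = a i" "\<And>i. x i ^ Suc (n i) = x i"
    and "\<And>i. of_nat (Suc (n i)) = (0::'a)"
  shows "(\<Sum>\<alpha>\<in>(\<Pi>\<^sub>E i\<in>UNIV. {..n i}).
           (\<Prod>i\<in>UNIV. lagrange_coeff (n i) (\<alpha> i) (a i)) * (\<Prod>i\<in>UNIV. x i ^ \<alpha> i)) = of_bool (a = x)"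
proof -
  have "(\<Sum>\<alpha>\<in>(\<Pi>\<^sub>E i\<in>UNIV. {..n i}).
           (\<Prod>i\<in>UNIV. lagrange_coeff (n i) (\<alpha> i) (a i)) * (\<Prod>i\<in>UNIV. x i ^ \<alpha> i)) =
        (\<Prod>i\<in>UNIV. \<Sum>k\<le>n i. lagrange_coeff (n i) k (a i) * x i ^ k)"
    by (subst prod_sum_PiE) (simp_all add: prod.distrib)
  also have "\<dots> = (\<Prod>i\<in>UNIV. of_bool (a i = x i))"
    using assms by (simp add: sum_lagrange_coeff)
  also have "\<dots> = of_bool (a = x)"
    by (auto simp: fun_eq_iff)
  finally show ?thesis .
qed

text \<open>Expanding the product, the coefficient of \<open>x\<^bsup>\<alpha>\<^esup>\<close> becomes a combination of monomials
  in the node, each of degree at most \<open>\<Sum>i. n i - \<alpha> i\<close>. A linear functional killing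
  all of these kills the coefficient.\<close>

lemma sum_prod_lagrange_coeff_eq_0:
  fixes a :: "'b \<Rightarrow> 's::finite \<Rightarrow> 'a::comm_ring_1" and w :: "'b \<Rightarrow> 'a"
  assumes orth: "\<And>\<beta>. (\<Sum>i\<in>UNIV. \<beta> i) \<le> (\<Sum>i\<in>UNIV. n i - \<alpha> i) \<Longrightarrow>
                   (\<Sum>j\<in>J. w j * (\<Prod>i\<in>UNIV. a j i ^ \<beta> i)) = 0"
  shows "(\<Sum>j\<in>J. w j * (\<Prod>i\<in>UNIV. lagrange_coeff (n i) (\<alpha> i) (a j i))) = 0"
proof -
  define \<beta> where "\<beta> T i = (if i \<in> T then 0 else n i - \<alpha> i)" for T i
  define c :: "'s set \<Rightarrow> 'a"
    where "c T = (\<Prod>i\<in>T. of_bool (\<alpha> i = 0)) * (\<Prod>i\<in>UNIV - T. - 1)" for T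
  have mon: "(\<Prod>i\<in>UNIV - T. - (y i ^ (n i - \<alpha> i))) =
             (\<Prod>i\<in>UNIV - T. - 1) * (\<Prod>i\<in>UNIV. y i ^ \<beta> T i)" for T and y :: "'s \<Rightarrow> 'a"
  proof -
    have "(\<Prod>i\<in>UNIV. y i ^ \<beta> T i) = (\<Prod>i\<in>UNIV - T. y i ^ (n i - \<alpha> i))"
      by (rule prod.mono_neutral_cong_right) (auto simp: \<beta>_def)
    then show ?thesis by (simp only: prod.distrib[symmetric] mult_minus1)
  qed
  have expand: "(\<Prod>i\<in>UNIV. lagrange_coeff (n i) (\<alpha> i) (y i)) =
        (\<Sum>T\<in>Pow UNIV. c T * (\<Prod>i\<in>UNIV. y i ^ \<beta> T i))" for y :: "'s \<Rightarrow> 'a"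
    using prod_add[of "UNIV :: 's set" "\<lambda>i. of_bool (\<alpha> i = 0)" "\<lambda>i. - (y i ^ (n i - \<alpha> i))"]
    by (simp add: lagrange_coeff_def mon c_def mult.assoc)
  have "(\<Sum>j\<in>J. w j * (\<Prod>i\<in>UNIV. lagrange_coeff (n i) (\<alpha> i) (a j i))) =
        (\<Sum>T\<in>Pow UNIV. c T * (\<Sum>j\<in>J. w j * (\<Prod>i\<in>UNIV. a j i ^ \<beta> T i)))"
    unfolding expand sum_distrib_left
    by (subst sum.swap) (simp add: mult.left_commute)
  also have "\<dots> = 0"
    by (intro sum.neutral ballI) (subst orth, auto simp: \<beta>_def intro!: sum_mono)
  finally show ?thesis .
qed

section \<open>Reed--Muller-type codes and their duals\<close>

lemma poly_eval_eq_sum_superset: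
  assumes "finite S" "Poly_Mapping.keys f \<subseteq> S"
  shows "poly_eval f x = (\<Sum>\<alpha>\<in>S. Poly_Mapping.lookup f \<alpha> * (\<Prod>i\<in>UNIV. x i ^ Poly_Mapping.lookup \<alpha> i))"
  unfolding poly_eval_def
  by (rule sum.mono_neutral_left) (use assms in \<open>auto simp: in_keys_iff\<close>)

lemma poly_eval_zero [simp]: "poly_eval 0 x = 0"
  by (simp add: poly_eval_def)

lemma poly_eval_add: "poly_eval (f + g) x = poly_eval f x + poly_eval g x"
proof -
  let ?S = "Poly_Mapping.keys f \<union> Poly_Mapping.keys g"
  have "finite ?S" "Poly_Mapping.keys (f + g) \<subseteq> ?S"
    by (auto simp: keys_add)
  then show ?thesis
    by (simp add: poly_eval_eq_sum_superset[of ?S] lookup_add distrib_right sum.distrib)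
qed

lemma poly_eval_sum: "poly_eval (\<Sum>k\<in>S. f k) x = (\<Sum>k\<in>S. poly_eval (f k) x)"
  by (induction S rule: infinite_finite_induct) (auto simp: poly_eval_add)

lemma poly_eval_single:
  "poly_eval (Poly_Mapping.single \<alpha> c) x = c * (\<Prod>i\<in>UNIV. x i ^ Poly_Mapping.lookup \<alpha> i)"
  by (subst poly_eval_eq_sum_superset[of "{\<alpha>}"]) auto

lemma single_in_polys_degree_le:
  "int (monomial_degree \<alpha>) \<le> d \<Longrightarrow> Poly_Mapping.single \<alpha> c \<in> polys_degree_le d"
  by (auto simp: polys_degree_le_def split: if_splits)

lemma sum_in_polys_degree_le:
  "(\<And>k. k \<in> S \<Longrightarrow> f k \<in> polys_degree_le d) \<Longrightarrow> (\<Sum>k\<in>S. f k) \<in> polys_degree_le d"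
  using keys_sum[of f S] by (fastforce simp: polys_degree_le_def)

lemma polys_degree_le_neg:
  assumes "d < 0"
  shows "polys_degree_le d = ({0} :: ('s::finite, 'a::comm_ring_1) mpolynomial set)"
proof -
  have "f = 0" if "f \<in> polys_degree_le d" for f :: "('s, 'a) mpolynomial"
    using that assms by (subst keys_eq_empty[symmetric]) (force simp: polys_degree_le_def)
  then show ?thesis by (auto simp: polys_degree_le_def)
qed

lemma reed_muller_type_code_neg:
  assumes "d < 0"
  shows "reed_muller_type_code m P d = {0\<^sub>v m}"
  by (auto simp: reed_muller_type_code_def polys_degree_le_neg[OF assms])

text \<open>Exponent vectors are plain functions from here on, since finitely supported
  functions on a finite type are all functions.\<close>

lemma vec_sum_monomials_in_reed_muller_type_code:
  fixes c :: "('s::finite \<Rightarrow> nat) \<Rightarrow> 'a::comm_ring_1"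
  assumes "\<And>\<alpha>. \<alpha> \<in> S \<Longrightarrow> int (\<Sum>i\<in>UNIV. \<alpha> i) \<le> d"
  shows "vec m (\<lambda>j. \<Sum>\<alpha>\<in>S. c \<alpha> * (\<Prod>i\<in>UNIV. P j i ^ \<alpha> i)) \<in> reed_muller_type_code m P d"
proof -
  let ?f = "\<Sum>\<alpha>\<in>S. Poly_Mapping.single (Abs_poly_mapping \<alpha>) (c \<alpha>)"
  have "?f \<in> polys_degree_le d"
    using assms by (intro sum_in_polys_degree_le single_in_polys_degree_le) (simp add: monomial_degree_def)
  moreover have "poly_eval ?f x = (\<Sum>\<alpha>\<in>S. c \<alpha> * (\<Prod>i\<in>UNIV. x i ^ \<alpha> i))" for x
    by (simp add: poly_eval_sum poly_eval_single)
  ultimately show ?thesis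
    unfolding reed_muller_type_code_def by (auto intro!: rev_image_eqI)
qed

lemma dual_reed_muller_type_code_iff:
  fixes P :: "nat \<Rightarrow> 's::finite \<Rightarrow> 'a::comm_ring_1"
  shows "w \<in> dual_code m (reed_muller_type_code m P d) \<longleftrightarrow>
    w \<in> carrier_vec m \<and>
    (\<forall>\<beta>. int (\<Sum>i\<in>UNIV. \<beta> i) \<le> d \<longrightarrow> (\<Sum>j<m. w $ j * (\<Prod>i\<in>UNIV. P j i ^ \<beta> i)) = 0)"
    (is "?L \<longleftrightarrow> _ \<and> (\<forall>\<beta>. ?deg \<beta> \<longrightarrow> ?orth \<beta> = 0)")
proof
  assume L: ?L
  have "?orth \<beta> = 0" if "?deg \<beta>" for \<beta>
  proof -
    let ?c = "vec m (\<lambda>j. \<Sum>\<alpha>\<in>{\<beta>}. 1 * (\<Prod>i\<in>UNIV. P j i ^ \<alpha> i))"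
    have "?c \<in> reed_muller_type_code m P d"
      by (rule vec_sum_monomials_in_reed_muller_type_code) (use that in auto)
    then have "w \<bullet> ?c = 0" using L unfolding dual_code_def by blast
    then show ?thesis by (simp add: scalar_prod_def lessThan_atLeast0)
  qed
  then show "w \<in> carrier_vec m \<and> (\<forall>\<beta>. ?deg \<beta> \<longrightarrow> ?orth \<beta> = 0)"
    using L by (simp add: dual_code_def)
next
  assume R: "w \<in> carrier_vec m \<and> (\<forall>\<beta>. ?deg \<beta> \<longrightarrow> ?orth \<beta> = 0)"
  have "w \<bullet> vec m (\<lambda>j. poly_eval f (P j)) = 0" if f: "f \<in> polys_degree_le d" for f
  proof -
    have "w \<bullet> vec m (\<lambda>j. poly_eval f (P j)) = (\<Sum>j<m. w $ j * poly_eval f (P j))"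
      by (simp add: scalar_prod_def lessThan_atLeast0)
    also have "\<dots> = (\<Sum>\<alpha>\<in>Poly_Mapping.keys f. Poly_Mapping.lookup f \<alpha> * ?orth (Poly_Mapping.lookup \<alpha>))"
      unfolding poly_eval_def sum_distrib_left
      by (subst sum.swap) (simp add: mult.left_commute)
    also have "\<dots> = 0"
      using R f by (intro sum.neutral) (auto simp: polys_degree_le_def monomial_degree_def)
    finally show ?thesis .
  qed
  then show ?L using R by (auto simp: dual_code_def reed_muller_type_code_def)
qed

section \<open>Duality on a grid\<close>

lemma sum_grid_monomial_eq_0:
  fixes B :: "'s::finite \<Rightarrow> 'a::field set"
  assumes "\<And>i. finite (B i)" "\<And>i k. k < n i \<Longrightarrow> (\<Sum>b\<in>B i. b ^ k) = 0"
    and "(\<Sum>i\<in>UNIV. \<gamma> i) < (\<Sum>i\<in>UNIV. n i)"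
  shows "(\<Sum>x\<in>Pi\<^sub>E UNIV B. \<Prod>i\<in>UNIV. x i ^ \<gamma> i) = 0"
proof -
  obtain i where "\<gamma> i < n i"
    using assms(3) by (meson linorder_not_less sum_mono)
  then have "(\<Prod>i\<in>UNIV. \<Sum>b\<in>B i. b ^ \<gamma> i) = 0"
    using assms(2) by (intro prod_zero) auto
  then show ?thesis
    using assms(1) by (simp add: prod_sum_PiE)
qed

lemma reed_muller_type_code_subset_dual:
  fixes P :: "nat \<Rightarrow> 's::finite \<Rightarrow> 'a::field"
  assumes P: "bij_betw P {..<m} (Pi\<^sub>E UNIV B)"
    and "\<And>i. finite (B i)" "\<And>i k. k < n i \<Longrightarrow> (\<Sum>b\<in>B i. b ^ k) = 0"
    and d': "d + d' < int (\<Sum>i\<in>UNIV. n i)"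
  shows "reed_muller_type_code m P d' \<subseteq> dual_code m (reed_muller_type_code m P d)"
proof
  fix w assume "w \<in> reed_muller_type_code m P d'"
  then obtain f where f: "f \<in> polys_degree_le d'" and w: "w = vec m (\<lambda>j. poly_eval f (P j))"
    by (auto simp: reed_muller_type_code_def)
  have "(\<Sum>j<m. w $ j * (\<Prod>i\<in>UNIV. P j i ^ \<beta> i)) = 0" if \<beta>: "int (\<Sum>i\<in>UNIV. \<beta> i) \<le> d" for \<beta>
  proof -
    have "(\<Sum>j<m. w $ j * (\<Prod>i\<in>UNIV. P j i ^ \<beta> i)) =
          (\<Sum>j<m. poly_eval f (P j) * (\<Prod>i\<in>UNIV. P j i ^ \<beta> i))"
      by (simp add: w)
    also have "\<dots> = (\<Sum>x\<in>Pi\<^sub>E UNIV B. poly_eval f x * (\<Prod>i\<in>UNIV. x i ^ \<beta> i))"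
      by (rule sum.reindex_bij_betw[OF P])
    also have "\<dots> = (\<Sum>\<alpha>\<in>Poly_Mapping.keys f. Poly_Mapping.lookup f \<alpha> *
        (\<Sum>x\<in>Pi\<^sub>E UNIV B. \<Prod>i\<in>UNIV. x i ^ (Poly_Mapping.lookup \<alpha> i + \<beta> i)))"
      unfolding poly_eval_def sum_distrib_left sum_distrib_right
      by (subst sum.swap) (simp add: power_add prod.distrib mult.assoc)
    also have "\<dots> = 0"
    proof (intro sum.neutral ballI)
      fix \<alpha> assume "\<alpha> \<in> Poly_Mapping.keys f"
      then have "int (\<Sum>i\<in>UNIV. Poly_Mapping.lookup \<alpha> i) \<le> d'"
        using f by (auto simp: polys_degree_le_def monomial_degree_def)
      then have "int (\<Sum>i\<in>UNIV. Poly_Mapping.lookup \<alpha> i + \<beta> i) < int (\<Sum>i\<in>UNIV. n i)"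
        using \<beta> d' unfolding sum.distrib of_nat_add by linarith
      then have "(\<Sum>i\<in>UNIV. Poly_Mapping.lookup \<alpha> i + \<beta> i) < (\<Sum>i\<in>UNIV. n i)"
        by linarith
      then show "Poly_Mapping.lookup f \<alpha> *
          (\<Sum>x\<in>Pi\<^sub>E UNIV B. \<Prod>i\<in>UNIV. x i ^ (Poly_Mapping.lookup \<alpha> i + \<beta> i)) = 0"
        using sum_grid_monomial_eq_0[of B n, OF assms(2,3)] by simp
    qed
    finally show ?thesis .
  qed
  then show "w \<in> dual_code m (reed_muller_type_code m P d)"
    by (simp add: dual_reed_muller_type_code_iff w)
qed

lemma dual_subset_reed_muller_type_code:
  fixes P :: "nat \<Rightarrow> 's::finite \<Rightarrow> 'a::field"
  assumes inj: "inj_on P {..<m}"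
    and root: "\<And>i j. j < m \<Longrightarrow> P j i ^ Suc (n i) = P j i"
    and char: "\<And>i. of_nat (Suc (n i)) = (0::'a)"
    and d': "int (\<Sum>i\<in>UNIV. n i) \<le> d + d' + 1"
  shows "dual_code m (reed_muller_type_code m P d) \<subseteq> reed_muller_type_code m P d'"
proof
  fix w assume "w \<in> dual_code m (reed_muller_type_code m P d)"
  then have w: "w \<in> carrier_vec m"
    and orth: "\<And>\<beta>. int (\<Sum>i\<in>UNIV. \<beta> i) \<le> d \<Longrightarrow> (\<Sum>j<m. w $ j * (\<Prod>i\<in>UNIV. P j i ^ \<beta> i)) = 0"
    by (auto simp: dual_reed_muller_type_code_iff)
  define Box where "Box = (\<Pi>\<^sub>E i\<in>UNIV. {..n i})"
  define S where "S = {\<alpha> \<in> Box. int (\<Sum>i\<in>UNIV. \<alpha> i) \<le> d'}"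
  define c where "c \<alpha> = (\<Sum>j<m. w $ j * (\<Prod>i\<in>UNIV. lagrange_coeff (n i) (\<alpha> i) (P j i)))" for \<alpha>
  have "finite Box" unfolding Box_def by (intro finite_PiE) auto
  have c0: "c \<alpha> = 0" if "\<alpha> \<in> Box - S" for \<alpha>
    unfolding c_def
  proof (rule sum_prod_lagrange_coeff_eq_0, rule orth)
    fix \<beta> :: "'s \<Rightarrow> nat" assume "sum \<beta> UNIV \<le> (\<Sum>i\<in>UNIV. n i - \<alpha> i)"
    moreover have "(\<Sum>i\<in>UNIV. n i - \<alpha> i) + (\<Sum>i\<in>UNIV. \<alpha> i) = (\<Sum>i\<in>UNIV. n i)"
      unfolding sum.distrib[symmetric] using that by (intro sum.cong refl le_add_diff_inverse2) (auto simp: Box_def)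
    moreover have "d' < int (\<Sum>i\<in>UNIV. \<alpha> i)" using that by (auto simp: S_def)
    ultimately show "int (sum \<beta> UNIV) \<le> d" using d' by linarith
  qed
  have "w $ l = (\<Sum>\<alpha>\<in>S. c \<alpha> * (\<Prod>i\<in>UNIV. P l i ^ \<alpha> i))" if l: "l < m" for l
  proof -
    have "(\<Sum>\<alpha>\<in>S. c \<alpha> * (\<Prod>i\<in>UNIV. P l i ^ \<alpha> i)) = (\<Sum>\<alpha>\<in>Box. c \<alpha> * (\<Prod>i\<in>UNIV. P l i ^ \<alpha> i))"
      by (rule sum.mono_neutral_left) (use \<open>finite Box\<close> c0 in \<open>auto simp: S_def\<close>)
    also have "\<dots> = (\<Sum>j<m. w $ j * (\<Sum>\<alpha>\<in>Box.
        (\<Prod>i\<in>UNIV. lagrange_coeff (n i) (\<alpha> i) (P j i)) * (\<Prod>i\<in>UNIV. P l i ^ \<alpha> i)))"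
      unfolding c_def sum_distrib_left sum_distrib_right
      by (subst sum.swap) (simp add: mult.assoc)
    also have "\<dots> = (\<Sum>j<m. w $ j * of_bool (P j = P l))"
      unfolding Box_def using root char l by (intro sum.cong refl) (subst sum_prod_lagrange_coeff, auto)
    also have "\<dots> = (\<Sum>j<m. if j = l then w $ j else 0)"
      using inj l by (intro sum.cong) (auto dest: inj_onD)
    finally show ?thesis using l by simp
  qed
  then have "w = vec m (\<lambda>j. \<Sum>\<alpha>\<in>S. c \<alpha> * (\<Prod>i\<in>UNIV. P j i ^ \<alpha> i))"
    using w by auto
  also have "\<dots> \<in> reed_muller_type_code m P d'"
    by (rule vec_sum_monomials_in_reed_muller_type_code) (simp add: S_def)
  finally show "w \<in> reed_muller_type_code m P d'" .
qed

theorem proposition7p12: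
  fixes A B :: "'s::finite \<Rightarrow> 'a::{field, finite} set"
    and e :: "'s \<Rightarrow> nat"
    and p m :: nat
    and X :: "('s \<Rightarrow> 'a) set"
    and P :: "nat \<Rightarrow> 's \<Rightarrow> 'a"
    and r0 d :: int
  assumes "CHAR('a) = p"
    and "\<And>i. subgroup (A i) (Multiplicative_Group.mult_of (class_ring :: 'a ring))"
    and "\<And>i. B i = A i \<union> {0}"
    and "\<And>i. e i = card (B i)"
    and "X = {x. \<forall>i. x i \<in> B i}"
    and "bij_betw P {..<m} X"
    and "r0 = (\<Sum>i\<in>UNIV. int (e i) - 1)"
    and "\<And>i. gcd (e i) p = p"
    and "-1 \<le> d" and "d \<le> r0"
  shows "(d < r0 \<longrightarrow> dual_code m (reed_muller_type_code m P d) = reed_muller_type_code m P (r0 - d - 1)) \<and>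
         (d = r0 \<longrightarrow> dual_code m (reed_muller_type_code m P d) = {0\<^sub>v m})"
proof -
  define n where "n i = card (A i)" for i
  have fin: "finite (A i)" for i by simp
  have nz: "0 \<notin> A i" for i
    using subgroup.subset[OF assms(2), of i] by auto
  have mult: "x * y \<in> A i" if "x \<in> A i" "y \<in> A i" for i x y
    using subgroup.m_closed[OF assms(2) that] by (simp add: mult_of_def)
  have B: "B i = insert 0 (A i)" for i using assms(3) by auto
  have e: "e i = Suc (n i)" for i
    using nz by (simp add: assms(4) B n_def)
  have char: "of_nat (Suc (n i)) = (0::'a)" for i
    using assms(8)[of i] unfolding e of_nat_eq_0_iff_char_dvd assms(1) by (metis gcd_dvd1)
  have r0: "r0 = int (\<Sum>i\<in>UNIV. n i)"
    by (simp add: assms(7) e)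
  have X: "X = Pi\<^sub>E UNIV B" by (auto simp: assms(5))
  have pow: "(\<Sum>b\<in>B i. b ^ k) = 0" if "k < n i" for i k
    unfolding B
  proof (rule power_sum_insert_zero_eq_0[OF fin nz])
    show "of_nat (card (A i) + 1) = (0::'a)" using char[of i] by (simp add: n_def)
    show "k < card (A i)" using that by (simp only: n_def)
  qed (rule mult)
  have root: "b ^ Suc (n i) = b" if "b \<in> B i" for i b
  proof (cases "b = 0")
    case False
    then have "b \<in> A i" using that by (simp add: B)
    then have "b ^ card (A i) = 1" by (intro power_card_eq_one fin nz mult)
    then show ?thesis by (simp add: n_def)
  qed simp
  have P: "bij_betw P {..<m} (Pi\<^sub>E UNIV B)" using assms(6) X by simp
  have Pin: "P j i \<in> B i" if "j < m" for i j
    using bij_betw_apply[OF P, of j] that by auto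
  have dual: "dual_code m (reed_muller_type_code m P d) = reed_muller_type_code m P (r0 - d - 1)"
  proof
    show "dual_code m (reed_muller_type_code m P d) \<subseteq> reed_muller_type_code m P (r0 - d - 1)"
    proof (rule dual_subset_reed_muller_type_code[where n = n])
      show "inj_on P {..<m}" using P by (rule bij_betw_imp_inj_on)
      show "P j i ^ Suc (n i) = P j i" if "j < m" for i j using root Pin[OF that] .
      show "of_nat (Suc (n i)) = (0::'a)" for i by (rule char)
      show "int (\<Sum>i\<in>UNIV. n i) \<le> d + (r0 - d - 1) + 1" by (simp only: r0)
    qed
    show "reed_muller_type_code m P (r0 - d - 1) \<subseteq> dual_code m (reed_muller_type_code m P d)"
    proof (rule reed_muller_type_code_subset_dual[OF P])
      show "finite (B i)" for i by simp
      show "(\<Sum>b\<in>B i. b ^ k) = 0" if "k < n i" for i k using that by (rule pow)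
      show "d + (r0 - d - 1) < int (\<Sum>i\<in>UNIV. n i)" by (simp add: r0)
    qed
  qed
  have "reed_muller_type_code m P (r0 - d - 1) = {0\<^sub>v m}" if "d = r0"
    by (rule reed_muller_type_code_neg) (simp add: that)
  with dual show ?thesis by metis
qed

end
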